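(* Let $a,b,m,n$ be positive integers and let $R_1=\langle r_1,\ldots,r_a\rangle$, $R_2=\langle r'_1,\ldots,r'_m\rangle$, $R_3=\langle r''_1,\ldots,r''_m\rangle$, $S_1=\langle s_1,\ldots,s_b\rangle$, $S_2=\langle s'_1,\ldots,s'_n\rangle$, $S_3=\langle s''_1,\ldots,s''_n\rangle$ be vectors of nonnegative integers. Let $u=r_1+\cdots+r_a$, $u'=r'_1+\cdots+r'_m$, $u''=r''_1+\cdots+r''_m$, and suppose $u'\neq u''$. If $\mathcal{D}_1,\mathcal{D}_2,\mathcal{D}_3$ are antichains in the Bruhat orders of $\mathcal{A}(R_1,S_1)$, $\mathcal{A}(R_2,S_2)$, $\mathcal{A}(R_3,S_3)$ respectively, then there is an antichain of size $|\mathcal{D}_1|\,|\mathcal{D}_2|^{u}\,|\mathcal{D}_3|^{ab-u}$ in the Bruhat order of the class $\mathcal{A}(R,S)$, where $R=R_1\otimes R_2+(b-R_1)\otimes R_3$ and $S=S_1\otimes S_2+(a-S_1)\otimes S_3$.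
   Context: For vectors $R=\langle r_1,\ldots,r_p\rangle$, $S=\langle s_1,\ldots,s_q\rangle$ of nonnegative integers, $\mathcal{A}(R,S)$ is the class of all $p\times q$ matrices with entries in $\{0,1\}$ whose $i$-th row sums to $r_i$ and $j$-th column sums to $s_j$. For a $(0,1)$-matrix $A=[a_{ij}]$ let $\sigma_{ij}(A)=\sum_{k=1}^{i}\sum_{\ell=1}^{j}a_{k\ell}$; for $A,C$ in the same class, $A\preceq_B C$ (Bruhat order) iff $\sigma_{ij}(A)\geqslant\sigma_{ij}(C)$ for all $i,j$. An antichain is a set of pairwise incomparable elements. For vectors $U=\langle u_1,\ldots,u_p\rangle$ and $V=\langle v_1,\ldots,v_q\rangle$, the Kronecker product $U\otimes V$ is the vector of length $pq$ whose entry in position $(i-1)q+k$ is $u_iv_k$. For a constant $t$, $t-U$ denotes $\langle t-u_1,\ldots,t-u_p\rangle$. *)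

theory Defs
  imports "Jordan_Normal_Form.Matrix"
begin

text \<open>
  Vectors and matrices are indexed from 0. Integer entries are used so that the subtraction in
  \<open>const_minus_vec\<close> is not truncated; nonnegativity of the margins is stated where it is assumed.
\<close>

definition margin_class :: "int vec \<Rightarrow> int vec \<Rightarrow> int mat set" where
  "margin_class R S = {A \<in> carrier_mat (dim_vec R) (dim_vec S).
     (\<forall>i<dim_vec R. \<forall>j<dim_vec S. A $$ (i, j) \<in> {0, 1}) \<and>
     (\<forall>i<dim_vec R. (\<Sum>j<dim_vec S. A $$ (i, j)) = R $ i) \<and>
     (\<forall>j<dim_vec S. (\<Sum>i<dim_vec R. A $$ (i, j)) = S $ j)}"

text \<open>The arguments \<open>i\<close> and \<open>j\<close> count rows and columns, so they range over
  \<open>{1..dim_row A}\<close> and \<open>{1..dim_col A}\<close> despite the 0-based matrix indices.\<close>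

definition corner_sum :: "int mat \<Rightarrow> nat \<Rightarrow> nat \<Rightarrow> int" where
  "corner_sum A i j = (\<Sum>k<i. \<Sum>l<j. A $$ (k, l))"

text \<open>Meaningful for two matrices of the same class; note the reversed inequality.\<close>

definition bruhat_le :: "int mat \<Rightarrow> int mat \<Rightarrow> bool" where
  "bruhat_le A C \<longleftrightarrow>
     (\<forall>i\<in>{1..dim_row A}. \<forall>j\<in>{1..dim_col A}. corner_sum A i j \<ge> corner_sum C i j)"

definition bruhat_antichain :: "int vec \<Rightarrow> int vec \<Rightarrow> int mat set \<Rightarrow> bool" where
  "bruhat_antichain R S D \<longleftrightarrow> D \<subseteq> margin_class R S \<and>
     (\<forall>A\<in>D. \<forall>C\<in>D. A \<noteq> C \<longrightarrow> \<not> bruhat_le A C \<and> \<not> bruhat_le C A)"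

definition kron_vec :: "int vec \<Rightarrow> int vec \<Rightarrow> int vec" where
  "kron_vec U V = vec (dim_vec U * dim_vec V)
     (\<lambda>k. U $ (k div dim_vec V) * V $ (k mod dim_vec V))"

definition const_minus_vec :: "int \<Rightarrow> int vec \<Rightarrow> int vec" where
  "const_minus_vec t U = vec (dim_vec U) (\<lambda>i. t - U $ i)"

end

theory Submission
  imports Defs
begin

text \<open>
  Replace every 1 of a matrix from \<open>D1\<close> by some matrix from \<open>D2\<close> and every 0 by some matrix from
  \<open>D3\<close>. At block corners, the corner sums of the result are an affine function of the corner sums of
  the outer matrix, with slope \<open>u' - u'' \<noteq> 0\<close>; hence different outer matrices give incomparable
  results. If the outer matrices agree, then inside block \<open>(i, j)\<close> all contributions of the other
  blocks to a corner sum are determined by the margins, so comparability of the results forces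
  comparability of the two matrices in every block.
\<close>

lemma sum_comp_zero_one:
  fixes f :: "'a \<Rightarrow> 'b::comm_ring_1" and g :: "'b \<Rightarrow> 'b"
  assumes "\<And>i. i \<in> I \<Longrightarrow> f i \<in> {0, 1}"
  shows "(\<Sum>i\<in>I. g (f i)) = sum f I * g 1 + (of_nat (card I) - sum f I) * g 0"
proof -
  have "(\<Sum>i\<in>I. g (f i)) = (\<Sum>i\<in>I. f i * g 1 + (1 - f i) * g 0)"
    using assms by (intro sum.cong) fastforce+
  then show ?thesis
    by (simp add: sum.distrib sum_subtractf flip: sum_distrib_right)
qed

lemma prod_comp_zero_one:
  fixes f :: "'a \<Rightarrow> int" and g :: "int \<Rightarrow> 'b::comm_monoid_mult"
  assumes "finite I" and "\<And>i. i \<in> I \<Longrightarrow> f i \<in> {0, 1}"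
  shows "(\<Prod>i\<in>I. g (f i)) = g 1 ^ nat (sum f I) * g 0 ^ nat (int (card I) - sum f I)"
proof -
  let ?ones = "{i \<in> I. f i = 1}" and ?zeros = "{i \<in> I. f i = 0}"
  have I: "I = ?ones \<union> ?zeros" "?ones \<inter> ?zeros = {}" and fin: "finite ?ones" "finite ?zeros"
    using assms by auto
  have "sum f I = sum f ?ones + sum f ?zeros"
    by (rule sum.union_disjoint[OF fin I(2), folded I(1)])
  then have sum_ones: "sum f I = int (card ?ones)"
    by simp
  have "card I = card ?ones + card ?zeros"
    by (rule card_Un_disjoint[OF fin I(2), folded I(1)])
  then have exponents: "nat (sum f I) = card ?ones" "nat (int (card I) - sum f I) = card ?zeros"
    using sum_ones by simp_all
  have "(\<Prod>i\<in>I. g (f i)) = (\<Prod>i\<in>?ones. g (f i)) * (\<Prod>i\<in>?zeros. g (f i))"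
    by (rule prod.union_disjoint[OF fin I(2), folded I(1)])
  then show ?thesis
    unfolding exponents by simp
qed

lemma sum_lessThan_div_mod:
  fixes f :: "nat \<Rightarrow> nat \<Rightarrow> 'a::comm_monoid_add"
  assumes "k \<le> m"
  shows "(\<Sum>x<i * m + k. f (x div m) (x mod m)) =
    (\<Sum>i'<i. \<Sum>k'<m. f i' k') + (\<Sum>k'<k. f i k')"
proof -
  let ?g = "\<lambda>x. f (x div m) (x mod m)"
  have block: "sum ?g {i' * m..<i' * m + d} = (\<Sum>k'<d. f i' k')" if "d \<le> m" for i' d
  proof -
    have "sum ?g {i' * m..<i' * m + d} = (\<Sum>k'<d. ?g (k' + i' * m))"
      using sum.shift_bounds_nat_ivl[of ?g 0 "i' * m" d]
      by (simp add: atLeast0LessThan add.commute)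
    also have "\<dots> = (\<Sum>k'<d. f i' k')"
      using that by (intro sum.cong) auto
    finally show ?thesis .
  qed
  have "sum ?g {..<i * m + k} = sum ?g {..<i * m} + sum ?g {i * m..<i * m + k}"
    using sum.atLeastLessThan_concat[of 0 "i * m" "i * m + k" ?g]
    by (simp add: atLeast0LessThan)
  then show ?thesis
    using assms by (simp add: block flip: sum.nat_group)
qed

lemma mult_add_le_mult:
  fixes i a k m :: nat
  assumes "i < a" and "k \<le> m"
  shows "i * m + k \<le> a * m"
proof -
  have "i * m + k \<le> Suc i * m" using \<open>k \<le> m\<close> by simp
  also have "\<dots> \<le> a * m" using \<open>i < a\<close> by (intro mult_le_mono1) simp
  finally show ?thesis .
qed

lemma margin_classD:
  assumes "A \<in> margin_class R S"
  shows "A \<in> carrier_mat (dim_vec R) (dim_vec S)"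
    and "\<And>i j. i < dim_vec R \<Longrightarrow> j < dim_vec S \<Longrightarrow> A $$ (i, j) \<in> {0, 1}"
    and "\<And>i. i < dim_vec R \<Longrightarrow> (\<Sum>j<dim_vec S. A $$ (i, j)) = R $ i"
    and "\<And>j. j < dim_vec S \<Longrightarrow> (\<Sum>i<dim_vec R. A $$ (i, j)) = S $ j"
  using assms by (auto simp: margin_class_def)

lemma finite_margin_class: "finite (margin_class R S)"
proof (rule finite_subset)
  let ?I = "{..<dim_vec R} \<times> {..<dim_vec S}"
  show "margin_class R S \<subseteq> mat (dim_vec R) (dim_vec S) ` (?I \<rightarrow>\<^sub>E {0, 1})"
  proof
    fix A assume A: "A \<in> margin_class R S"
    have "A = mat (dim_vec R) (dim_vec S) (restrict (($$) A) ?I)"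
      using margin_classD(1)[OF A] by (intro eq_matI) auto
    moreover have "restrict (($$) A) ?I \<in> ?I \<rightarrow>\<^sub>E {0, 1}"
      using margin_classD(2)[OF A] by (auto simp: restrict_PiE_iff)
    ultimately show "A \<in> mat (dim_vec R) (dim_vec S) ` (?I \<rightarrow>\<^sub>E {0, 1})"
      by (rule image_eqI)
  qed
  show "finite (mat (dim_vec R) (dim_vec S) ` (?I \<rightarrow>\<^sub>E {0, 1 :: int}))"
    by (intro finite_imageI finite_PiE) auto
qed

lemma corner_sum_0 [simp]: "corner_sum A 0 j = 0" "corner_sum A i 0 = 0"
  by (simp_all add: corner_sum_def)

lemma corner_sum_all_columns:
  assumes "A \<in> margin_class R S" and "i \<le> dim_vec R"
  shows "corner_sum A i (dim_vec S) = (\<Sum>k<i. R $ k)"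
  using assms by (auto simp: corner_sum_def margin_class_def intro!: sum.cong)

lemma corner_sum_all_rows:
  assumes "A \<in> margin_class R S" and "j \<le> dim_vec S"
  shows "corner_sum A (dim_vec R) j = (\<Sum>l<j. S $ l)"
  unfolding corner_sum_def sum.swap[of _ "{..<j}"]
  using assms by (auto simp: margin_class_def intro!: sum.cong)

lemma bruhat_le_refl [simp]: "bruhat_le A A"
  by (simp add: bruhat_le_def)

lemma bruhat_antichain_iff:
  "bruhat_antichain R S D \<longleftrightarrow>
     D \<subseteq> margin_class R S \<and> (\<forall>A\<in>D. \<forall>C\<in>D. bruhat_le A C \<longrightarrow> A = C)"
  unfolding bruhat_antichain_def by metis

definition block_mat :: "nat \<Rightarrow> nat \<Rightarrow> nat \<Rightarrow> nat \<Rightarrow> (nat \<times> nat \<Rightarrow> 'a mat) \<Rightarrow> 'a mat" where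
  "block_mat a b m n B =
     mat (a * m) (b * n) (\<lambda>(x, y). B (x div m, y div n) $$ (x mod m, y mod n))"

lemma dim_block_mat [simp]:
  "dim_row (block_mat a b m n B) = a * m" "dim_col (block_mat a b m n B) = b * n"
  by (simp_all add: block_mat_def)

lemma block_mat_index:
  assumes "x < a * m" and "y < b * n"
  shows "block_mat a b m n B $$ (x, y) = B (x div m, y div n) $$ (x mod m, y mod n)"
  using assms by (simp add: block_mat_def)

lemma sum_row_block_mat:
  fixes B :: "nat \<times> nat \<Rightarrow> 'a::comm_monoid_add mat"
  assumes "x < a * m"
  shows "(\<Sum>y<b * n. block_mat a b m n B $$ (x, y)) =
    (\<Sum>j<b. \<Sum>l<n. B (x div m, j) $$ (x mod m, l))"
  using sum_lessThan_div_mod[of 0 n "\<lambda>j l. B (x div m, j) $$ (x mod m, l)" b] assms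
  by (simp add: block_mat_index)

lemma sum_col_block_mat:
  fixes B :: "nat \<times> nat \<Rightarrow> 'a::comm_monoid_add mat"
  assumes "y < b * n"
  shows "(\<Sum>x<a * m. block_mat a b m n B $$ (x, y)) =
    (\<Sum>i<a. \<Sum>k<m. B (i, y div n) $$ (k, y mod n))"
  using sum_lessThan_div_mod[of 0 m "\<lambda>i k. B (i, y div n) $$ (k, y mod n)" a] assms
  by (simp add: block_mat_index)

lemma block_mat_margin_class:
  assumes margins: "\<And>p. p \<in> {..<a} \<times> {..<b} \<Longrightarrow> P p \<in> carrier_vec m"
      "\<And>p. p \<in> {..<a} \<times> {..<b} \<Longrightarrow> Q p \<in> carrier_vec n"
    and B: "\<And>p. p \<in> {..<a} \<times> {..<b} \<Longrightarrow> B p \<in> margin_class (P p) (Q p)"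
  shows "block_mat a b m n B \<in> margin_class
    (vec (a * m) (\<lambda>x. \<Sum>j<b. P (x div m, j) $ (x mod m)))
    (vec (b * n) (\<lambda>y. \<Sum>i<a. Q (i, y div n) $ (y mod n)))"
proof -
  have block: "B (i, j) \<in> margin_class (P (i, j)) (Q (i, j))"
    "dim_vec (P (i, j)) = m" "dim_vec (Q (i, j)) = n" if "i < a" "j < b" for i j
    using B margins that by auto
  have row: "x div m < a" "x mod m < m" if "x < a * m" for x
    using that by (cases "m = 0"; simp add: less_mult_imp_div_less)+
  have col: "y div n < b" "y mod n < n" if "y < b * n" for y
    using that by (cases "n = 0"; simp add: less_mult_imp_div_less)+
  have "block_mat a b m n B $$ (x, y) \<in> {0, 1}" if "x < a * m" "y < b * n" for x y
    unfolding block_mat_index[OF that] using row[OF that(1)] col[OF that(2)]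
    by (intro margin_classD(2)[OF block(1)]) (simp_all add: block)
  moreover have "(\<Sum>y<b * n. block_mat a b m n B $$ (x, y)) =
      (\<Sum>j<b. P (x div m, j) $ (x mod m))" if x: "x < a * m" for x
    unfolding sum_row_block_mat[OF x]
    using margin_classD(3)[OF block(1)] row[OF x] block by (intro sum.cong) auto
  moreover have "(\<Sum>x<a * m. block_mat a b m n B $$ (x, y)) =
      (\<Sum>i<a. Q (i, y div n) $ (y mod n))" if y: "y < b * n" for y
    unfolding sum_col_block_mat[OF y]
    using margin_classD(4)[OF block(1)] col[OF y] block by (intro sum.cong) auto
  ultimately show ?thesis
    by (auto simp: margin_class_def)
qed

lemma corner_sum_block_mat:
  assumes "k \<le> m" and "l \<le> n" and "i * m + k \<le> a * m" and "j * n + l \<le> b * n"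
  shows "corner_sum (block_mat a b m n B) (i * m + k) (j * n + l) =
    (\<Sum>i'<i. \<Sum>j'<j. corner_sum (B (i', j')) m n) + (\<Sum>i'<i. corner_sum (B (i', j)) m l) +
    (\<Sum>j'<j. corner_sum (B (i, j')) k n) + corner_sum (B (i, j)) k l"
proof -
  define row_sum where "row_sum i' k' =
    (\<Sum>j'<j. \<Sum>l'<n. B (i', j') $$ (k', l')) + (\<Sum>l'<l. B (i', j) $$ (k', l'))" for i' k'
  have "corner_sum (block_mat a b m n B) (i * m + k) (j * n + l) =
      (\<Sum>x<i * m + k. \<Sum>y<j * n + l. B (x div m, y div n) $$ (x mod m, y mod n))"
    unfolding corner_sum_def using assms(3,4) by (intro sum.cong block_mat_index) auto
  also have "\<dots> = (\<Sum>x<i * m + k. row_sum (x div m) (x mod m))"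
    unfolding row_sum_def by (intro sum.cong refl sum_lessThan_div_mod assms(2))
  also have "\<dots> = (\<Sum>i'<i. \<Sum>k'<m. row_sum i' k') + (\<Sum>k'<k. row_sum i k')"
    by (rule sum_lessThan_div_mod[OF assms(1)])
  also have "\<dots> = (\<Sum>i'<i. \<Sum>j'<j. corner_sum (B (i', j')) m n) +
      (\<Sum>i'<i. corner_sum (B (i', j)) m l) +
      (\<Sum>j'<j. corner_sum (B (i, j')) k n) + corner_sum (B (i, j)) k l"
    by (simp add: row_sum_def corner_sum_def sum.distrib sum.swap[of _ "{..<j}" "{..<m}"]
        sum.swap[of _ "{..<j}" "{..<k}"])
  finally show ?thesis .
qed

lemma corner_sum_block_mat_diff:
  assumes margins: "\<And>p. p \<in> {..<a} \<times> {..<b} \<Longrightarrow> P p \<in> carrier_vec m"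
      "\<And>p. p \<in> {..<a} \<times> {..<b} \<Longrightarrow> Q p \<in> carrier_vec n"
    and B: "\<And>p. p \<in> {..<a} \<times> {..<b} \<Longrightarrow> B p \<in> margin_class (P p) (Q p)"
    and B': "\<And>p. p \<in> {..<a} \<times> {..<b} \<Longrightarrow> B' p \<in> margin_class (P p) (Q p)"
    and ij: "i < a" "j < b" and kl: "k \<le> m" "l \<le> n"
  shows "corner_sum (block_mat a b m n B) (i * m + k) (j * n + l) -
      corner_sum (block_mat a b m n B') (i * m + k) (j * n + l) =
    corner_sum (B (i, j)) k l - corner_sum (B' (i, j)) k l"
proof -
  have all_columns: "corner_sum (B p) k' n = corner_sum (B' p) k' n"
    if "p \<in> {..<a} \<times> {..<b}" "k' \<le> m" for p k'
    using corner_sum_all_columns[OF B] corner_sum_all_columns[OF B'] margins that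
    by (metis carrier_vecD)
  have all_rows: "corner_sum (B p) m l' = corner_sum (B' p) m l'"
    if "p \<in> {..<a} \<times> {..<b}" "l' \<le> n" for p l'
    using corner_sum_all_rows[OF B] corner_sum_all_rows[OF B'] margins that
    by (metis carrier_vecD)
  have "i * m + k \<le> a * m" "j * n + l \<le> b * n"
    using ij kl by (simp_all add: mult_add_le_mult)
  moreover have
    "(\<Sum>i'<i. \<Sum>j'<j. corner_sum (B (i', j')) m n) = (\<Sum>i'<i. \<Sum>j'<j. corner_sum (B' (i', j')) m n)"
    "(\<Sum>i'<i. corner_sum (B (i', j)) m l) = (\<Sum>i'<i. corner_sum (B' (i', j)) m l)"
    "(\<Sum>j'<j. corner_sum (B (i, j')) k n) = (\<Sum>j'<j. corner_sum (B' (i, j')) k n)"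
    using ij kl by (auto intro!: sum.cong all_columns all_rows)
  ultimately show ?thesis
    using kl by (simp add: corner_sum_block_mat)
qed

lemma bruhat_le_block_matD:
  assumes margins: "\<And>p. p \<in> {..<a} \<times> {..<b} \<Longrightarrow> P p \<in> carrier_vec m"
      "\<And>p. p \<in> {..<a} \<times> {..<b} \<Longrightarrow> Q p \<in> carrier_vec n"
    and B: "\<And>p. p \<in> {..<a} \<times> {..<b} \<Longrightarrow> B p \<in> margin_class (P p) (Q p)"
    and B': "\<And>p. p \<in> {..<a} \<times> {..<b} \<Longrightarrow> B' p \<in> margin_class (P p) (Q p)"
    and block_le: "bruhat_le (block_mat a b m n B) (block_mat a b m n B')"
    and ij: "i < a" "j < b"
  shows "bruhat_le (B (i, j)) (B' (i, j))"
  unfolding bruhat_le_def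
proof (intro ballI)
  fix k l assume "k \<in> {1..dim_row (B (i, j))}" "l \<in> {1..dim_col (B (i, j))}"
  moreover have "B (i, j) \<in> carrier_mat m n"
    using margin_classD(1)[OF B] margins ij by (metis SigmaI carrier_vecD lessThan_iff)
  ultimately have kl: "1 \<le> k" "k \<le> m" "1 \<le> l" "l \<le> n"
    by auto
  then have "i * m + k \<in> {1..a * m}" "j * n + l \<in> {1..b * n}"
    using ij by (simp_all add: mult_add_le_mult)
  then have "corner_sum (block_mat a b m n B') (i * m + k) (j * n + l)
      \<le> corner_sum (block_mat a b m n B) (i * m + k) (j * n + l)"
    using block_le by (auto simp: bruhat_le_def)
  moreover have "corner_sum (block_mat a b m n B) (i * m + k) (j * n + l) -
      corner_sum (block_mat a b m n B') (i * m + k) (j * n + l) =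
    corner_sum (B (i, j)) k l - corner_sum (B' (i, j)) k l"
    using margins B B' ij kl(2,4) by (rule corner_sum_block_mat_diff)
  ultimately show "corner_sum (B' (i, j)) k l \<le> corner_sum (B (i, j)) k l"
    by linarith
qed

lemma corner_sum_block_mat_zero_one:
  assumes zero_one: "\<And>p. p \<in> {..<a} \<times> {..<b} \<Longrightarrow> A $$ p \<in> {0, 1}"
    and total: "\<And>p. p \<in> {..<a} \<times> {..<b} \<Longrightarrow> corner_sum (B p) m n = t (A $$ p)"
    and ij: "i \<le> a" "j \<le> b"
  shows "corner_sum (block_mat a b m n B) (i * m) (j * n) =
    corner_sum A i j * (t 1 - t 0) + int (i * j) * t 0"
proof -
  have "corner_sum (block_mat a b m n B) (i * m) (j * n) =
      (\<Sum>p\<in>{..<i} \<times> {..<j}. corner_sum (B p) m n)"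
    using corner_sum_block_mat[of 0 m 0 n i a j b B] ij
    by (simp add: sum.cartesian_product')
  also have "\<dots> = (\<Sum>p\<in>{..<i} \<times> {..<j}. t (A $$ p))"
    using ij by (intro sum.cong total) auto
  also have "\<dots> = corner_sum A i j * t 1 + (int (i * j) - corner_sum A i j) * t 0"
    using sum_comp_zero_one[of "{..<i} \<times> {..<j}" "($$) A" t, OF zero_one] ij
    by (auto simp: corner_sum_def sum.cartesian_product')
  finally show ?thesis
    by (simp add: algebra_simps)
qed

lemma bruhat_le_block_mat_imp_comparable:
  assumes A: "A \<in> carrier_mat a b" "A' \<in> carrier_mat a b"
    and zero_one: "\<And>p. p \<in> {..<a} \<times> {..<b} \<Longrightarrow> A $$ p \<in> {0, 1}"
      "\<And>p. p \<in> {..<a} \<times> {..<b} \<Longrightarrow> A' $$ p \<in> {0, 1}"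
    and total: "\<And>p. p \<in> {..<a} \<times> {..<b} \<Longrightarrow> corner_sum (B p) m n = t (A $$ p)"
      "\<And>p. p \<in> {..<a} \<times> {..<b} \<Longrightarrow> corner_sum (B' p) m n = t (A' $$ p)"
    and "t 1 \<noteq> t 0" and "0 < m" and "0 < n"
    and block_le: "bruhat_le (block_mat a b m n B) (block_mat a b m n B')"
  shows "bruhat_le A A' \<or> bruhat_le A' A"
proof -
  have scaled_le: "corner_sum A' i j * (t 1 - t 0) \<le> corner_sum A i j * (t 1 - t 0)"
    if "i \<in> {1..a}" "j \<in> {1..b}" for i j
  proof -
    have "i * m \<in> {1..a * m}" "j * n \<in> {1..b * n}"
      using that \<open>0 < m\<close> \<open>0 < n\<close> by (auto simp: Suc_le_eq)
    then have "corner_sum (block_mat a b m n B') (i * m) (j * n)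
        \<le> corner_sum (block_mat a b m n B) (i * m) (j * n)"
      using block_le by (auto simp: bruhat_le_def)
    moreover have "corner_sum (block_mat a b m n B) (i * m) (j * n) =
        corner_sum A i j * (t 1 - t 0) + int (i * j) * t 0"
      using zero_one(1) total(1) that by (intro corner_sum_block_mat_zero_one) auto
    moreover have "corner_sum (block_mat a b m n B') (i * m) (j * n) =
        corner_sum A' i j * (t 1 - t 0) + int (i * j) * t 0"
      using zero_one(2) total(2) that by (intro corner_sum_block_mat_zero_one) auto
    ultimately show ?thesis
      by simp
  qed
  consider (increasing) "0 < t 1 - t 0" | (decreasing) "t 1 - t 0 < 0"
    using \<open>t 1 \<noteq> t 0\<close> by linarith
  then show ?thesis
  proof cases
    case increasing
    then have "bruhat_le A A'"
      using scaled_le A by (simp add: bruhat_le_def)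
    then show ?thesis ..
  next
    case decreasing
    then have "bruhat_le A' A"
      using scaled_le A by (simp add: bruhat_le_def mult_le_cancel_right)
    then show ?thesis ..
  qed
qed

definition block_families :: "('a \<Rightarrow> 'b set) \<Rightarrow> 'a mat \<Rightarrow> (nat \<times> nat \<Rightarrow> 'b) set" where
  "block_families D A = (\<Pi>\<^sub>E p\<in>{..<dim_row A} \<times> {..<dim_col A}. D (A $$ p))"

lemma block_familiesD:
  assumes "B \<in> block_families D A" and "A \<in> carrier_mat a b" and "p \<in> {..<a} \<times> {..<b}"
  shows "B p \<in> D (A $$ p)"
  using assms by (auto simp: block_families_def)

lemma finite_block_families:
  assumes "\<And>e. finite (D e)"
  shows "finite (block_families D A)"
  unfolding block_families_def using assms by (intro finite_PiE) auto

lemma card_block_families: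
  assumes A: "A \<in> margin_class R S"
  shows "card (block_families D A) = card (D 1) ^ nat (\<Sum>i<dim_vec R. R $ i) *
    card (D 0) ^ nat (int (dim_vec R * dim_vec S) - (\<Sum>i<dim_vec R. R $ i))"
proof -
  let ?I = "{..<dim_vec R} \<times> {..<dim_vec S}"
  have "(\<Sum>p\<in>?I. A $$ p) = (\<Sum>i<dim_vec R. R $ i)"
    using margin_classD(3)[OF A] by (simp add: sum.cartesian_product')
  moreover have "card (block_families D A) = (\<Prod>p\<in>?I. card (D (A $$ p)))"
    using margin_classD(1)[OF A] by (auto simp: block_families_def card_PiE)
  moreover have "A $$ p \<in> {0, 1}" if "p \<in> ?I" for p
    using margin_classD(2)[OF A] that by (cases p) simp
  ultimately show ?thesis
    using prod_comp_zero_one[of ?I "($$) A" "\<lambda>e. card (D e)"] by simp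
qed

lemma sum_row_comp_margin_class:
  assumes A: "A \<in> margin_class R S" and "i < dim_vec R"
  shows "(\<Sum>j<dim_vec S. g (A $$ (i, j))) = R $ i * g 1 + (int (dim_vec S) - R $ i) * g 0"
  using sum_comp_zero_one[of "{..<dim_vec S}" "\<lambda>j. A $$ (i, j)" g] margin_classD[OF A] assms(2)
  by simp

lemma sum_col_comp_margin_class:
  assumes A: "A \<in> margin_class R S" and "j < dim_vec S"
  shows "(\<Sum>i<dim_vec R. g (A $$ (i, j))) = S $ j * g 1 + (int (dim_vec R) - S $ j) * g 0"
  using sum_comp_zero_one[of "{..<dim_vec R}" "\<lambda>i. A $$ (i, j)" g] margin_classD[OF A] assms(2)
  by simp

definition block_margin :: "int \<Rightarrow> int vec \<Rightarrow> (int \<Rightarrow> int vec) \<Rightarrow> int vec" where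
  "block_margin t U V = kron_vec U (V 1) + kron_vec (const_minus_vec t U) (V 0)"

lemma dim_block_margin [simp]: "dim_vec (block_margin t U V) = dim_vec U * dim_vec (V 0)"
  by (simp add: block_margin_def kron_vec_def const_minus_vec_def)

lemma block_margin_index:
  assumes "V 1 \<in> carrier_vec m" and "V 0 \<in> carrier_vec m" and "x < dim_vec U * m"
  shows "block_margin t U V $ x =
    U $ (x div m) * V 1 $ (x mod m) + (t - U $ (x div m)) * V 0 $ (x mod m)"
  using assms
  by (simp add: block_margin_def kron_vec_def const_minus_vec_def less_mult_imp_div_less)

lemma row_margin_eq_block_margin:
  assumes A: "A \<in> margin_class R S" and V: "V 1 \<in> carrier_vec m" "V 0 \<in> carrier_vec m"
  shows "vec (dim_vec R * m) (\<lambda>x. \<Sum>j<dim_vec S. V (A $$ (x div m, j)) $ (x mod m)) =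
    block_margin (int (dim_vec S)) R V"
proof (rule eq_vecI)
  fix x assume "x < dim_vec (block_margin (int (dim_vec S)) R V)"
  then have x: "x < dim_vec R * m"
    using V by simp
  then have "x div m < dim_vec R"
    by (rule less_mult_imp_div_less)
  then show "vec (dim_vec R * m) (\<lambda>x. \<Sum>j<dim_vec S. V (A $$ (x div m, j)) $ (x mod m)) $ x =
      block_margin (int (dim_vec S)) R V $ x"
    using x by (simp add: block_margin_index[OF V]
        sum_row_comp_margin_class[OF A, of _ "\<lambda>e. V e $ (x mod m)"])
qed (use V in simp)

lemma col_margin_eq_block_margin:
  assumes A: "A \<in> margin_class R S" and V: "V 1 \<in> carrier_vec n" "V 0 \<in> carrier_vec n"
  shows "vec (dim_vec S * n) (\<lambda>y. \<Sum>i<dim_vec R. V (A $$ (i, y div n)) $ (y mod n)) =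
    block_margin (int (dim_vec R)) S V"
proof (rule eq_vecI)
  fix y assume "y < dim_vec (block_margin (int (dim_vec R)) S V)"
  then have y: "y < dim_vec S * n"
    using V by simp
  then have "y div n < dim_vec S"
    by (rule less_mult_imp_div_less)
  then show "vec (dim_vec S * n) (\<lambda>y. \<Sum>i<dim_vec R. V (A $$ (i, y div n)) $ (y mod n)) $ y =
      block_margin (int (dim_vec R)) S V $ y"
    using y by (simp add: block_margin_index[OF V]
        sum_col_comp_margin_class[OF A, of _ "\<lambda>e. V e $ (y mod n)"])
qed (use V in simp)

text \<open>
  The blocks that replace an entry \<open>e\<close> are taken from \<open>\<D> e\<close>; only \<open>e = 0\<close> and \<open>e = 1\<close> matter.
\<close>

locale block_antichains =
  fixes a b m n :: nat
    and R S :: "int vec" and P Q :: "int \<Rightarrow> int vec"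
    and \<A> :: "int mat set" and \<D> :: "int \<Rightarrow> int mat set"
  assumes block_dims_pos: "0 < m" "0 < n"
    and outer_carrier: "R \<in> carrier_vec a" "S \<in> carrier_vec b"
    and block_carrier: "\<And>e. P e \<in> carrier_vec m" "\<And>e. Q e \<in> carrier_vec n"
    and outer_antichain: "bruhat_antichain R S \<A>"
    and block_antichain: "\<And>e. bruhat_antichain (P e) (Q e) (\<D> e)"
    and block_totals_neq: "(\<Sum>i<m. P 1 $ i) \<noteq> (\<Sum>i<m. P 0 $ i)"
begin

definition substitutions :: "(int mat \<times> (nat \<times> nat \<Rightarrow> int mat)) set" where
  "substitutions = Sigma \<A> (block_families \<D>)"

definition block_mats :: "int mat set" where
  "block_mats = (\<lambda>(A, B). block_mat a b m n B) ` substitutions"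

lemma outer_margin_class: "A \<in> \<A> \<Longrightarrow> A \<in> margin_class R S"
  using outer_antichain by (auto simp: bruhat_antichain_def)

lemma block_subset_margin_class: "\<D> e \<subseteq> margin_class (P e) (Q e)"
  using block_antichain by (simp add: bruhat_antichain_def)

lemma outer_carrier_mat: "A \<in> \<A> \<Longrightarrow> A \<in> carrier_mat a b"
  using margin_classD(1)[OF outer_margin_class] outer_carrier by auto

lemma block_mem:
  assumes "A \<in> \<A>" and "B \<in> block_families \<D> A" and "p \<in> {..<a} \<times> {..<b}"
  shows "B p \<in> \<D> (A $$ p)"
  using block_familiesD assms outer_carrier_mat by blast

lemma block_mem_margin_class:
  assumes "A \<in> \<A>" and "B \<in> block_families \<D> A" and "p \<in> {..<a} \<times> {..<b}"
  shows "B p \<in> margin_class (P (A $$ p)) (Q (A $$ p))"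
  using block_mem[OF assms] block_subset_margin_class by blast

lemma bruhat_le_block_mat_imp_outer_eq:
  assumes A: "A \<in> \<A>" "A' \<in> \<A>" and B: "B \<in> block_families \<D> A" "B' \<in> block_families \<D> A'"
    and block_le: "bruhat_le (block_mat a b m n B) (block_mat a b m n B')"
  shows "A = A'"
proof -
  have zero_one: "X $$ p \<in> {0, 1}" if "X \<in> \<A>" "p \<in> {..<a} \<times> {..<b}" for X p
    using margin_classD(2)[OF outer_margin_class] that outer_carrier by fastforce
  have total: "corner_sum (C p) m n = (\<Sum>i<m. P (X $$ p) $ i)"
    if "X \<in> \<A>" "C \<in> block_families \<D> X" "p \<in> {..<a} \<times> {..<b}" for X C p
    using corner_sum_all_columns[OF block_mem_margin_class[OF that]] block_carrier
    by (metis carrier_vecD order_refl)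
  have "bruhat_le A A' \<or> bruhat_le A' A"
    using outer_carrier_mat[OF A(1)] outer_carrier_mat[OF A(2)] zero_one[OF A(1)] zero_one[OF A(2)]
      total[OF A(1) B(1)] total[OF A(2) B(2)] block_totals_neq block_dims_pos block_le
    by (rule bruhat_le_block_mat_imp_comparable)
  then show ?thesis
    using outer_antichain A by (auto simp: bruhat_antichain_iff)
qed

lemma bruhat_le_block_mat_imp_blocks_eq:
  assumes A: "A \<in> \<A>" and B: "B \<in> block_families \<D> A" "B' \<in> block_families \<D> A"
    and block_le: "bruhat_le (block_mat a b m n B) (block_mat a b m n B')"
  shows "B = B'"
proof -
  have "B p = B' p" if p: "p \<in> {..<a} \<times> {..<b}" for p
  proof -
    have "bruhat_le (B p) (B' p)"
      using bruhat_le_block_matD[of a b "\<lambda>q. P (A $$ q)" m "\<lambda>q. Q (A $$ q)" n B B' "fst p" "snd p"]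
        block_carrier block_mem_margin_class[OF A] B block_le p by auto
    then show ?thesis
      using block_antichain[of "A $$ p"] block_mem[OF A B(1) p] block_mem[OF A B(2) p]
      by (auto simp: bruhat_antichain_iff)
  qed
  then show ?thesis
    using B outer_carrier_mat[OF A] by (auto simp: block_families_def intro: PiE_ext)
qed

lemma bruhat_le_block_mat_imp_eq:
  assumes "(A, B) \<in> substitutions" and "(A', B') \<in> substitutions"
    and "bruhat_le (block_mat a b m n B) (block_mat a b m n B')"
  shows "(A, B) = (A', B')"
  using bruhat_le_block_mat_imp_outer_eq[of A A' B B'] bruhat_le_block_mat_imp_blocks_eq[of A B B']
    assms by (auto simp: substitutions_def)

lemma bruhat_antichain_block_mats:
  "bruhat_antichain (block_margin (int b) R P) (block_margin (int a) S Q) block_mats"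
  unfolding bruhat_antichain_iff
proof (intro conjI ballI impI subsetI)
  fix M assume "M \<in> block_mats"
  then obtain A B where A: "A \<in> \<A>" and B: "B \<in> block_families \<D> A"
    and M: "M = block_mat a b m n B"
    by (auto simp: block_mats_def substitutions_def)
  have "M \<in> margin_class (vec (a * m) (\<lambda>x. \<Sum>j<b. P (A $$ (x div m, j)) $ (x mod m)))
      (vec (b * n) (\<lambda>y. \<Sum>i<a. Q (A $$ (i, y div n)) $ (y mod n)))"
    unfolding M using block_carrier block_mem_margin_class[OF A B]
    by (intro block_mat_margin_class)
  then show "M \<in> margin_class (block_margin (int b) R P) (block_margin (int a) S Q)"
    using row_margin_eq_block_margin[OF outer_margin_class[OF A], of P m]
      col_margin_eq_block_margin[OF outer_margin_class[OF A], of Q n] block_carrier outer_carrier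
    by simp
next
  fix M M' assume "M \<in> block_mats" "M' \<in> block_mats" "bruhat_le M M'"
  then show "M = M'"
    using bruhat_le_block_mat_imp_eq by (fastforce simp: block_mats_def)
qed

lemma card_block_mats:
  "card block_mats = card \<A> * card (\<D> 1) ^ nat (\<Sum>i<a. R $ i) *
     card (\<D> 0) ^ nat (int (a * b) - (\<Sum>i<a. R $ i))"
proof -
  have "inj_on (\<lambda>(A, B). block_mat a b m n B) substitutions"
    using bruhat_le_block_mat_imp_eq by (fastforce intro: inj_onI)
  then have "card block_mats = card substitutions"
    unfolding block_mats_def by (rule card_image)
  also have "\<dots> = (\<Sum>A\<in>\<A>. card (block_families \<D> A))"
  proof -
    have "finite \<A>" "\<And>e. finite (\<D> e)"
      using outer_margin_class block_subset_margin_class finite_margin_class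
      by (meson finite_subset subsetI)+
    then show ?thesis
      unfolding substitutions_def by (intro card_SigmaI) (auto intro: finite_block_families)
  qed
  also have "\<dots> = (\<Sum>A\<in>\<A>. card (\<D> 1) ^ nat (\<Sum>i<a. R $ i) *
      card (\<D> 0) ^ nat (int (a * b) - (\<Sum>i<a. R $ i)))"
    using card_block_families[OF outer_margin_class] outer_carrier by (intro sum.cong) auto
  finally show ?thesis
    by simp
qed

end

theorem theorem6:
  fixes a b m n :: nat
    and R1 R2 R3 S1 S2 S3 R S :: "int vec"
    and u u' u'' :: int
    and D1 D2 D3 :: "int mat set"
  assumes "0 < a" and "0 < b" and "0 < m" and "0 < n"
    and "R1 \<in> carrier_vec a" and "R2 \<in> carrier_vec m" and "R3 \<in> carrier_vec m"
    and "S1 \<in> carrier_vec b" and "S2 \<in> carrier_vec n" and "S3 \<in> carrier_vec n"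
    and "\<forall>i<a. 0 \<le> R1 $ i" and "\<forall>i<m. 0 \<le> R2 $ i" and "\<forall>i<m. 0 \<le> R3 $ i"
    and "\<forall>j<b. 0 \<le> S1 $ j" and "\<forall>j<n. 0 \<le> S2 $ j" and "\<forall>j<n. 0 \<le> S3 $ j"
    and "u = (\<Sum>i<a. R1 $ i)" and "u' = (\<Sum>i<m. R2 $ i)" and "u'' = (\<Sum>i<m. R3 $ i)"
    and "u' \<noteq> u''"
    and "bruhat_antichain R1 S1 D1" and "bruhat_antichain R2 S2 D2"
    and "bruhat_antichain R3 S3 D3"
    and "R = kron_vec R1 R2 + kron_vec (const_minus_vec (int b) R1) R3"
    and "S = kron_vec S1 S2 + kron_vec (const_minus_vec (int a) S1) S3"
  shows "\<exists>D. bruhat_antichain R S D \<and>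
    card D = card D1 * card D2 ^ nat u * card D3 ^ nat (int (a * b) - u)"
proof -
  interpret block_antichains a b m n R1 S1 "\<lambda>e. if e = 1 then R2 else R3"
    "\<lambda>e. if e = 1 then S2 else S3" D1 "\<lambda>e. if e = 1 then D2 else D3"
    using assms by unfold_locales auto
  have "bruhat_antichain R S block_mats"
    using bruhat_antichain_block_mats assms(24,25) by (simp add: block_margin_def)
  moreover have "card block_mats = card D1 * card D2 ^ nat u * card D3 ^ nat (int (a * b) - u)"
    using card_block_mats assms(17) by simp
  ultimately show ?thesis
    by blast
qed

end
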